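(* In the setting described in the context, suppose that the grading of $S=k[x_1,\ldots,x_r,x_{r+1}^{\pm1},\ldots,x_n^{\pm1}]$ by $A$ given by $L$ is positive, i.e. $S_0=k$. Let $a\in Q$. Then for any $\varphi=(\varphi_1,\ldots,\varphi_n)\in\mathbb{N}^r\times\mathbb{Z}^s$ such that $L\varphi=a$, the dimension of the $k$-vector space $S_a$ equals the number of lattice points (points of $M\cong\mathbb{Z}^l$) inside the polytope $$\mathcal{P}_\varphi=\{u\in M_{\mathbb{R}}\mid\langle u,v_i\rangle\ge-\varphi_i\text{ for all }i=1,\ldots,r\}.$$
   Context: $k$ is an algebraically closed field of characteristic $0$, $n=r+s$, $X=k^r\times(k^{\times})^s$, $S=k[x_1,\ldots,x_r,x_{r+1}^{\pm1},\ldots,x_n^{\pm1}]$. $H=(k^\times)^p\times\mathbb{F}$ with $\mathbb{F}$ a product of cyclic groups of orders $d_1,\ldots,d_t$; $m=p+t$; the character group $A=\mathrm{Hom}(H,k^\times)$ is identified with $\mathbb{Z}^p\oplus\mathbb{Z}/d_1\mathbb{Z}\oplus\cdots\oplus\mathbb{Z}/d_t\mathbb{Z}$. $H$ acts diagonally and faithfully on $X$ with weights $\eta_1,\ldots,\eta_n\in A$ ($h$ multiplies the $i$-th coordinate by $\eta_i(h)$), and $L$ is the $m\times n$ integer matrix whose $i$-th column represents $\eta_i$. The degree map is $\deg:\mathbb{Z}^n\to A$, $\deg(\lambda)=L\lambda$ (read in $A$), i.e. $\deg(\lambda)=\sum\lambda_i\eta_i$. For $a\in A$, $S_a=\mathrm{span}_k\{x^\lambda\in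 S\mid L\lambda=a\}$, and $Q=\deg(\mathbb{N}^r\times\mathbb{Z}^s)\subseteq A$, with $0\in\mathbb{N}$. Put $l=n-p$. The kernel $\mathfrak{K}$ of $\deg$ is free of rank $l$; fix an $n\times l$ integer matrix $K$ whose columns form a $\mathbb{Z}$-basis of $\mathfrak{K}$, and let $v_1,\ldots,v_r\in N=\mathbb{Z}^l$ be its first $r$ rows. $M=\mathrm{Hom}(N,\mathbb{Z})\cong\mathbb{Z}^l$, with natural pairing $\langle\cdot,\cdot\rangle$, and $M_{\mathbb{R}}=M\otimes\mathbb{R}$. *)

theory Defs
  imports
    Complex_Main
    "HOL-Library.Poly_Mapping"
    "HOL-Computational_Algebra.Polynomial"
    "Jordan_Normal_Form.Matrix"
begin

section \<open>The diagonalizable group and its action\<close>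

text \<open>
  The finite group \<open>F\<close> is realised as the product of the groups of \<open>d\<close>-th roots of unity, for \<open>d\<close> in
  the list \<open>ds\<close>; over an algebraically closed field of characteristic 0 these are cyclic of order \<open>d\<close>.
  Elements of \<open>H = (k\<^sup>\<times>)\<^sup>p \<times> F\<close> are vectors of length \<open>m = p + length ds\<close>, multiplied componentwise.
\<close>

definition diag_group :: "nat \<Rightarrow> nat list \<Rightarrow> 'k::field vec set" where
  "diag_group p ds =
     {h \<in> carrier_vec (p + length ds).
        (\<forall>i<p. h $ i \<noteq> 0) \<and> (\<forall>j<length ds. h $ (p + j) ^ (ds ! j) = 1)}"

text \<open>
  The character group \<open>A = \<int>\<^sup>p \<oplus> \<int>/d\<^sub>1 \<oplus> \<dots> \<oplus> \<int>/d\<^sub>t\<close> is represented by reduced integer vectors: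
  the last \<open>t\<close> entries are the least nonnegative residues. \<open>char_class\<close> is the projection
  \<open>\<int>\<^sup>m \<rightarrow> A\<close>; for positive \<open>ds\<close> two integer vectors represent the same element of \<open>A\<close> iff
  their images under it are equal.
\<close>

definition char_class :: "nat \<Rightarrow> nat list \<Rightarrow> int vec \<Rightarrow> int vec" where
  "char_class p ds a =
     vec (p + length ds) (\<lambda>i. if i < p then a $ i else a $ i mod int (ds ! (i - p)))"

definition character :: "int vec \<Rightarrow> 'k::field vec \<Rightarrow> 'k" where
  "character a h = (\<Prod>i<dim_vec a. h $ i powi a $ i)"

lemma character_char_class:
  fixes h :: "'k::field vec"
  assumes h: "h \<in> diag_group p ds" and a: "a \<in> carrier_vec (p + length ds)"
    and ds: "\<forall>d\<in>set ds. 0 < d"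
  shows "character (char_class p ds a) h = character a h"
proof -
  have "h $ i powi (char_class p ds a $ i) = h $ i powi (a $ i)" if i: "i < p + length ds" for i
  proof (cases "i < p")
    case True
    then show ?thesis by (simp add: char_class_def)
  next
    case False
    define d where "d = ds ! (i - p)"
    have "i - p < length ds" using i False by simp
    then have d: "0 < d" using ds by (simp add: d_def)
    from h have "\<forall>j<length ds. h $ (p + j) ^ (ds ! j) = 1"
      by (simp add: diag_group_def)
    then have "h $ (p + (i - p)) ^ d = 1"
      using \<open>i - p < length ds\<close> unfolding d_def by blast
    then have hd: "h $ i ^ d = 1" using False by simp
    then have nz: "h $ i \<noteq> 0" using d by (metis power_0_left less_numeral_extra(3) zero_neq_one)
    have "h $ i powi (a $ i) = h $ i powi (int d * (a $ i div int d) + a $ i mod int d)" by simp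
    also have "\<dots> = (h $ i powi int d) powi (a $ i div int d) * h $ i powi (a $ i mod int d)"
      using nz by (subst power_int_add) (simp_all add: power_int_mult)
    also have "\<dots> = h $ i powi (a $ i mod int d)" using hd by simp
    finally show ?thesis using False i by (simp add: char_class_def d_def)
  qed
  then show ?thesis using a
    by (auto simp: character_def char_class_def intro!: prod.cong)
qed

definition affine_torus :: "nat \<Rightarrow> nat \<Rightarrow> 'k::field vec set" where
  "affine_torus r s = {x \<in> carrier_vec (r + s). \<forall>i. r \<le> i \<and> i < r + s \<longrightarrow> x $ i \<noteq> 0}"

text \<open>The weight of the \<open>i\<close>-th coordinate is the character represented by column \<open>i\<close> of \<open>L\<close>.\<close>

definition diag_action :: "int mat \<Rightarrow> 'k::field vec \<Rightarrow> 'k vec \<Rightarrow> 'k vec" where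
  "diag_action L h x = vec (dim_col L) (\<lambda>i. character (col L i) h * x $ i)"

definition acts_faithfully ::
  "'k::field itself \<Rightarrow> nat \<Rightarrow> nat \<Rightarrow> nat \<Rightarrow> nat list \<Rightarrow> int mat \<Rightarrow> bool" where
  "acts_faithfully TYPE('k) r s p ds L \<longleftrightarrow>
     (\<forall>h \<in> (diag_group p ds :: 'k vec set).
        (\<forall>x \<in> affine_torus r s. diag_action L h x = x) \<longrightarrow> h = vec (p + length ds) (\<lambda>_. 1))"


section \<open>The degree map\<close>

definition exponents :: "nat \<Rightarrow> nat \<Rightarrow> int vec set" where
  "exponents r s = {\<mu> \<in> carrier_vec (r + s). \<forall>i<r. 0 \<le> \<mu> $ i}"

definition deg :: "nat \<Rightarrow> nat list \<Rightarrow> int mat \<Rightarrow> int vec \<Rightarrow> int vec" where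
  "deg p ds L \<mu> = char_class p ds (L *\<^sub>v \<mu>)"

definition deg_kernel :: "nat \<Rightarrow> nat \<Rightarrow> nat list \<Rightarrow> int mat \<Rightarrow> int vec set" where
  "deg_kernel n p ds L = {\<mu> \<in> carrier_vec n. deg p ds L \<mu> = 0\<^sub>v (p + length ds)}"

definition columns_form_Z_basis :: "int mat \<Rightarrow> int vec set \<Rightarrow> bool" where
  "columns_form_Z_basis K B \<longleftrightarrow>
     set (cols K) \<subseteq> B \<and> (\<forall>x\<in>B. \<exists>!c. c \<in> carrier_vec (dim_col K) \<and> K *\<^sub>v c = x)"


section \<open>The Laurent polynomial ring and its grading\<close>

text \<open>
  Laurent polynomials are finitely supported maps from exponents \<open>nat \<Rightarrow>\<^sub>0 int\<close> to \<open>k\<close>, with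
  the convolution product of \<open>HOL-Library.Poly_Mapping\<close>. This ambient type has infinitely many
  invertible variables, numbered from 0; \<open>laurent_ring r s\<close> is the subring
  \<open>k[x\<^sub>0, \<dots>, x\<^sub>r\<^sub>-\<^sub>1, x\<^sub>r\<^sup>\<plusminus>\<^sup>1, \<dots>, x\<^sub>r\<^sub>+\<^sub>s\<^sub>-\<^sub>1\<^sup>\<plusminus>\<^sup>1]\<close>.
\<close>

type_synonym 'k laurent = "(nat \<Rightarrow>\<^sub>0 int) \<Rightarrow>\<^sub>0 'k"

definition laurent_ring :: "nat \<Rightarrow> nat \<Rightarrow> 'k::field laurent set" where
  "laurent_ring r s =
     {f. \<forall>e \<in> Poly_Mapping.keys f.
           Poly_Mapping.keys e \<subseteq> {..<r + s} \<and> (\<forall>i<r. 0 \<le> Poly_Mapping.lookup e i)}"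

definition laurent_const :: "'k::field \<Rightarrow> 'k laurent" where
  "laurent_const c = Poly_Mapping.single 0 c"

definition laurent_monom :: "int vec \<Rightarrow> 'k::field laurent" where
  "laurent_monom \<mu> =
     Poly_Mapping.single (\<Sum>i<dim_vec \<mu>. Poly_Mapping.single i (\<mu> $ i)) 1"

definition laurent_scale :: "'k::field \<Rightarrow> 'k laurent \<Rightarrow> 'k laurent" where
  "laurent_scale c f = laurent_const c * f"

interpretation laurent: vector_space "laurent_scale :: 'k::field \<Rightarrow> 'k laurent \<Rightarrow> 'k laurent"
  by unfold_locales
    (simp_all add: laurent_scale_def laurent_const_def algebra_simps single_add
      mult_single flip: mult.assoc)

definition graded_piece ::
  "nat \<Rightarrow> nat \<Rightarrow> nat \<Rightarrow> nat list \<Rightarrow> int mat \<Rightarrow> int vec \<Rightarrow> 'k::field laurent set" where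
  "graded_piece r s p ds L a =
     laurent.span {laurent_monom \<mu> | \<mu>. \<mu> \<in> carrier_vec (r + s) \<and>
       (laurent_monom \<mu> :: 'k laurent) \<in> laurent_ring r s \<and> deg p ds L \<mu> = a}"

definition positive_grading ::
  "'k::field itself \<Rightarrow> nat \<Rightarrow> nat \<Rightarrow> nat \<Rightarrow> nat list \<Rightarrow> int mat \<Rightarrow> bool" where
  "positive_grading TYPE('k) r s p ds L \<longleftrightarrow>
     graded_piece r s p ds L (0\<^sub>v (p + length ds)) = range (laurent_const :: 'k \<Rightarrow> 'k laurent)"


section \<open>The polytope and its lattice points\<close>

text \<open>
  \<open>M\<^sub>\<real>\<close> is identified with \<open>\<real>\<^sup>l\<close> through the basis dual to the standard basis of \<open>N = \<int>\<^sup>l\<close>, so the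
  pairing becomes the scalar product and \<open>v\<^sub>i\<close> is row \<open>i\<close> of \<open>K\<close>.
\<close>

definition fiber_polytope :: "nat \<Rightarrow> int mat \<Rightarrow> int vec \<Rightarrow> real vec set" where
  "fiber_polytope r K \<phi> =
     {u \<in> carrier_vec (dim_col K).
        \<forall>i<r. u \<bullet> map_vec real_of_int (row K i) \<ge> - real_of_int (\<phi> $ i)}"

definition dual_lattice :: "nat \<Rightarrow> real vec set" where
  "dual_lattice l = map_vec real_of_int ` carrier_vec l"

definition bounded_vecs :: "real vec set \<Rightarrow> bool" where
  "bounded_vecs P \<longleftrightarrow> (\<exists>B. \<forall>u\<in>P. \<forall>j<dim_vec u. \<bar>u $ j\<bar> \<le> B)"

end

theory Submission
  imports "HOL-Analysis.Kronecker_Approximation_Theorem" Defs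
begin

text \<open>
  A basis of \<open>S\<^sub>a\<close> is given by the monomials \<open>x\<^sup>\<mu>\<close> with \<open>\<mu> \<in> \<nat>\<^sup>r \<times> \<int>\<^sup>s\<close> and \<open>deg \<mu> = a\<close>. Two exponents have the
  same degree exactly when they differ by an element of the kernel, so these \<open>\<mu>\<close> are the vectors
  \<open>\<phi> + K c\<close> with \<open>c \<in> \<int>\<^sup>l\<close>, each for a single \<open>c\<close> because the columns of \<open>K\<close> are a basis. The
  sign conditions on the first \<open>r\<close> entries of \<open>\<phi> + K c\<close> read \<open>\<langle>c, v\<^sub>i\<rangle> \<ge> - \<phi>\<^sub>i\<close>, which say that
  \<open>c\<close> lies in the polytope. This bijection (\<open>fibre_bij\<close>) yields the equality of dimension and number
  of lattice points, once the latter is known to be finite.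

  Finiteness comes from positivity. If \<open>c \<in> \<int>\<^sup>l\<close> satisfies \<open>\<langle>c, v\<^sub>i\<rangle> \<ge> 0\<close> for all \<open>i \<le> r\<close>, then
  \<open>x\<^bsup>K c\<^esup>\<close> is a monomial in \<open>S\<^sub>0 = k\<close>, so \<open>K c = 0\<close> and \<open>c = 0\<close>. Hence the recession cone of the
  polytope contains no nonzero lattice point. The cone is defined by integral inequalities, and
  Dirichlet's simultaneous approximation theorem turns this into a bound on the real points of
  the polytope (\<open>bounded_fiber_polytope\<close>): for a very long vector \<open>u\<close> of the
  polytope, some integer vector would lie so close to a bounded multiple of the direction of \<open>u\<close>
  that it would be a nonzero element of the cone.
\<close>

(* The dollar sign below always denotes the entry of a vector of variable dimension. *)
unbundle no vec_syntax

section \<open>Monomials in the Laurent polynomial ring\<close>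

definition exponent_of :: "int vec \<Rightarrow> nat \<Rightarrow>\<^sub>0 int" where
  "exponent_of \<mu> = (\<Sum>i<dim_vec \<mu>. Poly_Mapping.single i (\<mu> $ i))"

lemma laurent_monom_eq_single: "laurent_monom \<mu> = Poly_Mapping.single (exponent_of \<mu>) 1"
  by (simp add: laurent_monom_def exponent_of_def)

lemma lookup_exponent_of:
  "Poly_Mapping.lookup (exponent_of \<mu>) j = (if j < dim_vec \<mu> then \<mu> $ j else 0)"
  by (simp add: exponent_of_def lookup_sum lookup_single when_def)

lemma exponent_of_inject:
  assumes "\<mu> \<in> carrier_vec n" "\<nu> \<in> carrier_vec n" "exponent_of \<mu> = exponent_of \<nu>"
  shows "\<mu> = \<nu>"
proof (rule eq_vecI)
  show "dim_vec \<mu> = dim_vec \<nu>" using assms by simp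
  fix i assume "i < dim_vec \<nu>"
  then show "\<mu> $ i = \<nu> $ i"
    using lookup_exponent_of[of \<mu> i] lookup_exponent_of[of \<nu> i] assms by simp
qed

lemma inj_on_laurent_monom:
  assumes "E \<subseteq> carrier_vec n"
  shows "inj_on (laurent_monom :: int vec \<Rightarrow> 'k::field laurent) E"
proof (rule inj_onI)
  fix \<mu> \<nu> assume *: "\<mu> \<in> E" "\<nu> \<in> E" "laurent_monom \<mu> = (laurent_monom \<nu> :: 'k laurent)"
  then have "Poly_Mapping.keys (laurent_monom \<mu> :: 'k laurent) = Poly_Mapping.keys (laurent_monom \<nu> :: 'k laurent)"
    by simp
  then have "exponent_of \<mu> = exponent_of \<nu>"
    by (simp add: laurent_monom_eq_single)
  then show "\<mu> = \<nu>" using exponent_of_inject * assms by blast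
qed

lemma laurent_monom_in_ring_iff:
  assumes "\<mu> \<in> carrier_vec (r + s)"
  shows "(laurent_monom \<mu> :: 'k::field laurent) \<in> laurent_ring r s \<longleftrightarrow> \<mu> \<in> exponents r s"
proof -
  have "Poly_Mapping.keys (exponent_of \<mu>) \<subseteq> {..<r + s}"
    using assms by (auto simp: in_keys_iff lookup_exponent_of split: if_splits)
  then show ?thesis
    using assms by (simp add: laurent_ring_def laurent_monom_eq_single exponents_def lookup_exponent_of)
qed

text \<open>
  The coefficient at exponent \<open>e\<close> of a linear combination of monomials is the weight of the
  monomial with exponent \<open>e\<close>, so a vanishing combination has vanishing weights.
\<close>

lemma independent_singles:
  "laurent.independent ((\<lambda>e. Poly_Mapping.single e 1) ` E :: 'k::field laurent set)"
  unfolding laurent.independent_explicit_module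
proof (intro allI impI)
  fix T :: "'k laurent set" and w v
  assume fin: "finite T" and sub: "T \<subseteq> (\<lambda>e. Poly_Mapping.single e 1) ` E"
    and zero: "(\<Sum>v\<in>T. laurent_scale (w v) v) = 0" and v: "v \<in> T"
  from v sub obtain e where e: "v = Poly_Mapping.single e 1" by blast
  have coeff: "Poly_Mapping.lookup (laurent_scale (w u) u) e = (if u = v then w v else 0)" if "u \<in> T" for u
  proof -
    from that sub obtain e' where u: "u = Poly_Mapping.single e' 1" by blast
    from u e have "u = v \<longleftrightarrow> e' = e"
      by (metis lookup_single_eq lookup_single_not_eq zero_neq_one)
    then show ?thesis using e u
      by (auto simp: laurent_scale_def laurent_const_def mult_single lookup_single when_def)
  qed
  have "0 = Poly_Mapping.lookup (\<Sum>u\<in>T. laurent_scale (w u) u) e" by (simp add: zero)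
  also have "\<dots> = (\<Sum>u\<in>T. if u = v then w v else 0)" by (simp add: lookup_sum coeff)
  also have "\<dots> = w v" using fin v by simp
  finally show "w v = 0" by simp
qed

lemma independent_monomials: "laurent.independent (laurent_monom ` E :: 'k::field laurent set)"
proof -
  have "laurent_monom ` E = (\<lambda>e. Poly_Mapping.single e (1::'k)) ` exponent_of ` E"
    by (simp add: image_image laurent_monom_eq_single)
  then show ?thesis using independent_singles by metis
qed

lemma graded_piece_eq_span:
  "graded_piece r s p ds L a
     = laurent.span (laurent_monom ` {\<mu> \<in> exponents r s. deg p ds L \<mu> = a} :: 'k::field laurent set)"
proof -
  have "{laurent_monom \<mu> :: 'k laurent | \<mu>. \<mu> \<in> carrier_vec (r + s) \<and>
           (laurent_monom \<mu> :: 'k laurent) \<in> laurent_ring r s \<and> deg p ds L \<mu> = a}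
      = laurent_monom ` {\<mu> \<in> exponents r s. deg p ds L \<mu> = a}"
    using laurent_monom_in_ring_iff[where 'k = 'k] by (auto simp: exponents_def)
  then show ?thesis by (simp add: graded_piece_def)
qed

section \<open>Fibres of the degree map\<close>

text \<open>
  Taking the modulus \<open>0\<close> in the free coordinates treats them together with the cyclic ones, since
  divisibility by \<open>0\<close> means vanishing and \<open>x mod 0 = x\<close>.
\<close>

lemma deg_eq_iff:
  "deg p ds L \<mu> = deg p ds L \<nu> \<longleftrightarrow>
     (\<forall>i<p + length ds. int (if i < p then 0 else ds ! (i - p)) dvd (L *\<^sub>v \<mu>) $ i - (L *\<^sub>v \<nu>) $ i)"
proof -
  have "char_class p ds x = vec (p + length ds) (\<lambda>i. x $ i mod int (if i < p then 0 else ds ! (i - p)))" for x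
    by (simp add: char_class_def cong: if_cong) (auto intro!: eq_vecI)
  then show ?thesis
    by (auto simp: deg_def vec_eq_iff mod_eq_dvd_iff)
qed

lemma deg_kernel_iff:
  assumes L: "L \<in> carrier_mat (p + length ds) n"
  shows "\<mu> \<in> deg_kernel n p ds L \<longleftrightarrow> \<mu> \<in> carrier_vec n \<and>
     (\<forall>i<p + length ds. int (if i < p then 0 else ds ! (i - p)) dvd (L *\<^sub>v \<mu>) $ i)"
proof -
  have L0: "L *\<^sub>v 0\<^sub>v n = 0\<^sub>v (p + length ds)" using L by auto
  then have "deg p ds L (0\<^sub>v n) = 0\<^sub>v (p + length ds)"
    by (auto simp: deg_def char_class_def intro!: eq_vecI)
  then have "\<mu> \<in> deg_kernel n p ds L \<longleftrightarrow> \<mu> \<in> carrier_vec n \<and> deg p ds L \<mu> = deg p ds L (0\<^sub>v n)"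
    by (simp add: deg_kernel_def)
  then show ?thesis by (simp add: deg_eq_iff L0)
qed

lemma deg_eq_iff_diff_in_kernel:
  assumes L: "L \<in> carrier_mat (p + length ds) n"
    and "\<mu> \<in> carrier_vec n" "\<nu> \<in> carrier_vec n"
  shows "deg p ds L \<mu> = deg p ds L \<nu> \<longleftrightarrow> \<mu> - \<nu> \<in> deg_kernel n p ds L"
proof -
  have "(L *\<^sub>v (\<mu> - \<nu>)) $ i = (L *\<^sub>v \<mu>) $ i - (L *\<^sub>v \<nu>) $ i" if "i < p + length ds" for i
    using that assms mult_minus_distrib_mat_vec[OF L, of \<mu> \<nu>] by simp
  then show ?thesis using assms by (simp add: deg_eq_iff deg_kernel_iff[OF L])
qed

text \<open>
  The degree of \<open>K c\<close> is read off the matrix \<open>L K\<close>, whose entries in row \<open>i\<close> are all divisible by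
  the \<open>i\<close>-th modulus because the columns of \<open>K\<close> lie in the kernel.
\<close>

lemma combination_in_deg_kernel:
  assumes L: "L \<in> carrier_mat (p + length ds) n" and K: "K \<in> carrier_mat n l"
    and cols: "set (cols K) \<subseteq> deg_kernel n p ds L" and c: "c \<in> carrier_vec l"
  shows "K *\<^sub>v c \<in> deg_kernel n p ds L"
  unfolding deg_kernel_iff[OF L]
proof (intro conjI allI impI)
  show "K *\<^sub>v c \<in> carrier_vec n" using K c by simp
  fix i assume i: "i < p + length ds"
  let ?d = "int (if i < p then 0 else ds ! (i - p))"
  have entry: "?d dvd (L * K) $$ (i, j)" if "j < l" for j
  proof -
    have "col K j \<in> deg_kernel n p ds L"
      using cols K that by (auto simp: cols_def)
    then have "?d dvd (L *\<^sub>v col K j) $ i" using i by (simp only: deg_kernel_iff[OF L])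
    then show ?thesis using i that L K by simp
  qed
  have "(L *\<^sub>v (K *\<^sub>v c)) $ i = ((L * K) *\<^sub>v c) $ i"
    using assoc_mult_mat_vec[OF L K c] by simp
  also have "\<dots> = (\<Sum>j<l. (L * K) $$ (i, j) * c $ j)"
    using i L K c by (simp add: scalar_prod_def atLeast0LessThan del: assoc_mult_mat_vec)
  also have "?d dvd \<dots>" using entry by (intro dvd_sum) auto
  finally show "?d dvd (L *\<^sub>v (K *\<^sub>v c)) $ i" .
qed

text \<open>
  A fibre of \<open>deg\<close> is a translate of its kernel, and the basis \<open>K\<close> gives coordinates on the kernel.
  In these coordinates the nonnegativity of the first \<open>r\<close> exponents becomes the system of
  inequalities of the polytope.
\<close>

lemma fibre_bij:
  assumes L: "L \<in> carrier_mat (p + length ds) (r + s)" and K: "K \<in> carrier_mat (r + s) l"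
    and basis: "columns_form_Z_basis K (deg_kernel (r + s) p ds L)"
    and \<phi>: "\<phi> \<in> carrier_vec (r + s)"
  shows "bij_betw (\<lambda>c. \<phi> + K *\<^sub>v c)
     {c \<in> carrier_vec l. \<forall>i<r. - \<phi> $ i \<le> (K *\<^sub>v c) $ i}
     {\<mu> \<in> exponents r s. deg p ds L \<mu> = deg p ds L \<phi>}"
proof (rule bij_betw_imageI)
  let ?ker = "deg_kernel (r + s) p ds L"
  have cols: "set (cols K) \<subseteq> ?ker"
    and uniq: "\<And>x. x \<in> ?ker \<Longrightarrow> \<exists>!c. c \<in> carrier_vec l \<and> K *\<^sub>v c = x"
    using basis K by (auto simp: columns_form_Z_basis_def)
  note ker = combination_in_deg_kernel[OF L K cols]
  have diff: "\<phi> + K *\<^sub>v c - \<phi> = K *\<^sub>v c" if "c \<in> carrier_vec l" for c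
    using that K \<phi> by (auto intro!: eq_vecI)
  show "inj_on (\<lambda>c. \<phi> + K *\<^sub>v c) {c \<in> carrier_vec l. \<forall>i<r. - \<phi> $ i \<le> (K *\<^sub>v c) $ i}"
  proof (rule inj_onI, clarify)
    fix c c' assume c: "c \<in> carrier_vec l" "c' \<in> carrier_vec l" and "\<phi> + K *\<^sub>v c = \<phi> + K *\<^sub>v c'"
    then have "K *\<^sub>v c = K *\<^sub>v c'" using diff by metis
    then show "c = c'" using uniq[OF ker] c by metis
  qed
  show "(\<lambda>c. \<phi> + K *\<^sub>v c) ` {c \<in> carrier_vec l. \<forall>i<r. - \<phi> $ i \<le> (K *\<^sub>v c) $ i}
      = {\<mu> \<in> exponents r s. deg p ds L \<mu> = deg p ds L \<phi>}" (is "?f ` ?C = ?E")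
  proof (intro subset_antisym subsetI)
    fix \<mu> assume "\<mu> \<in> ?f ` ?C"
    then obtain c where c: "c \<in> carrier_vec l" "\<forall>i<r. - \<phi> $ i \<le> (K *\<^sub>v c) $ i"
      and \<mu>: "\<mu> = \<phi> + K *\<^sub>v c" by blast
    have car: "\<mu> \<in> carrier_vec (r + s)"
      using mult_mat_vec_carrier[OF K c(1)] \<phi> \<mu> by simp
    have "deg p ds L \<mu> = deg p ds L \<phi>"
      using deg_eq_iff_diff_in_kernel[OF L car \<phi>] ker[OF c(1)] diff[OF c(1)] \<mu> by simp
    moreover have "0 \<le> \<mu> $ i" if "i < r" for i
      using spec[OF c(2), of i] that K \<mu> \<phi> by simp
    ultimately show "\<mu> \<in> ?E" using car by (simp add: exponents_def)
  next
    fix \<mu> assume \<mu>: "\<mu> \<in> ?E"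
    then have car: "\<mu> \<in> carrier_vec (r + s)" by (simp add: exponents_def)
    then obtain c where c: "c \<in> carrier_vec l" "K *\<^sub>v c = \<mu> - \<phi>"
      using uniq[of "\<mu> - \<phi>"] deg_eq_iff_diff_in_kernel[OF L car \<phi>] \<mu> by blast
    have "\<mu> = \<phi> + K *\<^sub>v c" using c car \<phi> by (auto intro!: eq_vecI)
    moreover have "- \<phi> $ i \<le> (K *\<^sub>v c) $ i" if "i < r" for i
      using that \<mu> \<phi> car unfolding c(2) by (simp add: exponents_def)
    ultimately show "\<mu> \<in> ?f ` ?C" using c(1) by blast
  qed
qed

section \<open>Lattice points of the polytope\<close>

lemma lattice_points_eq:
  assumes K: "K \<in> carrier_mat n l" and "r \<le> n"
  shows "fiber_polytope r K \<phi> \<inter> dual_lattice l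
     = map_vec real_of_int ` {c \<in> carrier_vec l. \<forall>i<r. - \<phi> $ i \<le> (K *\<^sub>v c) $ i}"
proof -
  have "map_vec real_of_int c \<bullet> map_vec real_of_int (row K i) = real_of_int ((K *\<^sub>v c) $ i)"
    if "c \<in> carrier_vec l" "i < r" for c i
    using that assms by (simp add: scalar_prod_def mult.commute)
  then have "map_vec real_of_int c \<in> fiber_polytope r K \<phi> \<longleftrightarrow> (\<forall>i<r. - \<phi> $ i \<le> (K *\<^sub>v c) $ i)"
    if "c \<in> carrier_vec l" for c
    using that K by (simp add: fiber_polytope_def flip: of_int_minus)
  then show ?thesis by (auto simp: dual_lattice_def)
qed

lemma inj_map_vec_of_int: "inj (map_vec real_of_int)"
proof (rule injI)
  fix c c' :: "int vec" assume eq: "map_vec real_of_int c = map_vec real_of_int c'"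
  then have dim: "dim_vec c = dim_vec c'" by (metis index_map_vec(2))
  show "c = c'"
  proof (rule eq_vecI[OF _ dim])
    fix i assume "i < dim_vec c'"
    then show "c $ i = c' $ i"
      using arg_cong[OF eq, of "\<lambda>u. u $ i"] dim by simp
  qed
qed

lemma finite_bounded_lattice_points:
  assumes "bounded_vecs P"
  shows "finite (P \<inter> dual_lattice l)"
proof -
  from assms obtain B where B: "\<And>u j. u \<in> P \<Longrightarrow> j < dim_vec u \<Longrightarrow> \<bar>u $ j\<bar> \<le> B"
    unfolding bounded_vecs_def by blast
  let ?xs = "{xs. set xs \<subseteq> {- \<lfloor>B\<rfloor>..\<lfloor>B\<rfloor>} \<and> length xs = l}"
  have "P \<inter> dual_lattice l \<subseteq> (\<lambda>xs. map_vec real_of_int (vec_of_list xs)) ` ?xs"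
  proof
    fix u assume u: "u \<in> P \<inter> dual_lattice l"
    then obtain c where c: "c \<in> carrier_vec l" "u = map_vec real_of_int c"
      by (auto simp: dual_lattice_def)
    have "c $ j \<in> {- \<lfloor>B\<rfloor>..\<lfloor>B\<rfloor>}" if "j < l" for j
    proof -
      have "u $ j = real_of_int (c $ j)" "j < dim_vec u"
        using c that by simp_all
      then have "real_of_int \<bar>c $ j\<bar> \<le> B" using B[of u j] u by (metis IntD1 of_int_abs)
      then have "\<bar>c $ j\<bar> \<le> \<lfloor>B\<rfloor>" by (simp only: le_floor_iff)
      then show ?thesis by (simp only: atLeastAtMost_iff) arith
    qed
    then have "set (list_of_vec c) \<subseteq> {- \<lfloor>B\<rfloor>..\<lfloor>B\<rfloor>}"
      unfolding list_of_vec_map carrier_vecD[OF c(1)] by auto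
    then have "list_of_vec c \<in> ?xs" using c(1) by simp
    then show "u \<in> (\<lambda>xs. map_vec real_of_int (vec_of_list xs)) ` ?xs"
      by (rule rev_image_eqI) (simp only: c(2) vec_list)
  qed
  moreover have "finite ?xs" by (rule finite_lists_length_eq) simp
  ultimately show ?thesis using finite_subset[OF _ finite_imageI] by blast
qed

text \<open>
  Absence of lattice points in the recession cone suffices for boundedness. Suppose that \<open>u\<close> in
  the polytope has an entry of absolute value \<open>T\<close>. Dirichlet's theorem gives an integer \<open>q\<close>, positive
  and bounded independently of \<open>u\<close>, and an integer vector \<open>c\<close> close to \<open>(q/T) u\<close>. For large \<open>T\<close> the
  inequality \<open>\<langle>(q/T) u, v\<^sub>i\<rangle> \<ge> - q \<phi>\<^sub>i / T\<close> forces \<open>\<langle>c, v\<^sub>i\<rangle> > - 1\<close>. This pairing is an integer,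
  hence nonnegative, so \<open>c = 0\<close>. But the chosen entry of \<open>(q/T) u\<close> has absolute value \<open>q \<ge> 1\<close>,
  which is too large to be approximated by \<open>0\<close>.
\<close>

lemma bounded_fiber_polytope:
  assumes K: "K \<in> carrier_mat n l" and "r \<le> n"
    and no_recession: "\<And>c. c \<in> carrier_vec l \<Longrightarrow> \<forall>i<r. 0 \<le> (K *\<^sub>v c) $ i \<Longrightarrow> c = 0\<^sub>v l"
  shows "bounded_vecs (fiber_polytope r K \<phi>)"
proof -
  \<comment> \<open>The quality \<open>1/N\<close> of the approximation changes the pairing with a row of \<open>K\<close> by less than \<open>1/2\<close>;
      the bound \<open>B\<close>, with \<open>q \<le> N ^ l\<close>, leaves the other \<open>1/2\<close> to the offset \<open>q \<phi>\<^sub>i / T\<close>.\<close>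
  define C where "C = 1 + (\<Sum>i<r. \<Sum>j<l. \<bar>K $$ (i, j)\<bar>)"
  define F where "F = 1 + (\<Sum>i<r. \<bar>\<phi> $ i\<bar>)"
  define N where "N = nat (2 * C)"
  have C1: "1 \<le> C" unfolding C_def by (simp add: sum_nonneg)
  have F1: "1 \<le> F" unfolding F_def by (simp add: sum_nonneg)
  have N0: "0 < N" and N: "real N = 2 * real_of_int C" using C1 by (simp_all add: N_def)
  have row_less: "(\<Sum>j<l. \<bar>K $$ (i, j)\<bar>) < C" if "i < r" for i
    using member_le_sum[of i "{..<r}" "\<lambda>i. \<Sum>j<l. \<bar>K $$ (i, j)\<bar>"] that
    by (simp add: C_def sum_nonneg)
  have \<phi>_less: "\<phi> $ i < F" if "i < r" for i
    using member_le_sum[of i "{..<r}" "\<lambda>i. \<bar>\<phi> $ i\<bar>"] that by (simp add: F_def)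
  define B where "B = 2 * real (N ^ l) * real_of_int F"
  have "\<bar>u $ j\<^sub>0\<bar> \<le> B" if u: "u \<in> fiber_polytope r K \<phi>" and j\<^sub>0: "j\<^sub>0 < dim_vec u" for u j\<^sub>0
  proof (rule ccontr)
    assume "\<not> \<bar>u $ j\<^sub>0\<bar> \<le> B"
    define T where "T = \<bar>u $ j\<^sub>0\<bar>"
    have T: "B < T" using \<open>\<not> \<bar>u $ j\<^sub>0\<bar> \<le> B\<close> by (simp add: T_def)
    have "0 < B" using N0 F1 by (simp add: B_def)
    then have T0: "0 < T" using T by simp
    have ul: "dim_vec u = l" using u K by (simp add: fiber_polytope_def)
    obtain q z where q: "0 < q" "q \<le> int (N ^ l)"
      and approx: "\<And>j. j < l \<Longrightarrow> \<bar>of_int q * (u $ j / T) - of_int (z j)\<bar> < 1 / real N"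
      using Dirichlet_approx_simult[OF N0, of l "\<lambda>j. u $ j / T"] by metis
    define c where "c = vec l z"
    have "0 \<le> (K *\<^sub>v c) $ i" if i: "i < r" for i
    proof -
      let ?k = "\<lambda>j. real_of_int (K $$ (i, j))"
      have "\<bar>\<Sum>j<l. ?k j * (of_int q * (u $ j / T) - of_int (z j))\<bar> \<le> (\<Sum>j<l. \<bar>?k j\<bar> * (1 / N))"
      proof (rule order_trans[OF sum_abs sum_mono])
        fix j assume "j \<in> {..<l}"
        then show "\<bar>?k j * (of_int q * (u $ j / T) - of_int (z j))\<bar> \<le> \<bar>?k j\<bar> * (1 / N)"
          unfolding abs_mult using approx[of j] by (intro mult_left_mono) auto
      qed
      also have "\<dots> = real_of_int (\<Sum>j<l. \<bar>K $$ (i, j)\<bar>) / N"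
        by (simp add: sum_divide_distrib)
      also have "\<dots> < real_of_int C / N"
        using row_less[OF i] N0 by (intro divide_strict_right_mono) (simp_all only: of_int_less_iff of_nat_0_less_iff)
      also have "\<dots> = 1 / 2" using N C1 by simp
      finally have error: "\<bar>\<Sum>j<l. ?k j * (of_int q * (u $ j / T) - of_int (z j))\<bar> < 1 / 2" .
      have pairing: "- real_of_int (\<phi> $ i) \<le> (\<Sum>j<l. u $ j * ?k j)"
        using u i K \<open>r \<le> n\<close> by (simp add: fiber_polytope_def scalar_prod_def atLeast0LessThan)
      have "real_of_int q * real_of_int (\<phi> $ i) \<le> real_of_int q * real_of_int F"
        using \<phi>_less[OF i] q by simp
      also have "\<dots> \<le> real (N ^ l) * real_of_int F"
      proof (rule mult_right_mono)
        show "real_of_int q \<le> real (N ^ l)" using q(2) by linarith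
      qed (use F1 in simp)
      also have "\<dots> < T / 2" using T by (simp add: B_def)
      finally have "- (1 / 2) < - (q * real_of_int (\<phi> $ i)) / T"
        using T0 by (simp add: field_simps)
      also have "\<dots> \<le> q * (\<Sum>j<l. u $ j * ?k j) / T"
        using mult_left_mono[OF pairing, of "real_of_int q"] q T0
        by (intro divide_right_mono) simp_all
      also have "\<dots> = (\<Sum>j<l. ?k j * (of_int q * (u $ j / T)))"
        by (simp add: sum_distrib_left sum_divide_distrib mult_ac)
      finally have "- 1 < (\<Sum>j<l. ?k j * of_int (z j))"
        using error unfolding right_diff_distrib sum_subtractf by linarith
      also have "\<dots> = real_of_int ((K *\<^sub>v c) $ i)"
        using i K \<open>r \<le> n\<close> by (simp add: c_def scalar_prod_def atLeast0LessThan)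
      finally show ?thesis by linarith
    qed
    then have "c = 0\<^sub>v l" using no_recession[of c] by (simp add: c_def)
    then have "z j\<^sub>0 = 0" using j\<^sub>0 ul by (metis c_def index_vec index_zero_vec(1))
    then have "real_of_int q < 1 / real N"
      using approx[of j\<^sub>0] j\<^sub>0 ul q T0 by (simp add: T_def abs_mult)
    moreover have "1 / real N \<le> 1" using N0 by simp
    ultimately show False using q by linarith
  qed
  then show ?thesis unfolding bounded_vecs_def by blast
qed

text \<open>
  An exponent in the kernel gives a monomial in \<open>S\<^sub>0 = k\<close>, and the only monomial that is a constant
  is \<open>1\<close>.
\<close>

lemma positive_grading_kernel_exponent:
  assumes positive: "positive_grading TYPE('k::field) r s p ds L"
    and ker: "\<mu> \<in> deg_kernel (r + s) p ds L" and nonneg: "\<forall>i<r. 0 \<le> \<mu> $ i"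
  shows "\<mu> = 0\<^sub>v (r + s)"
proof -
  have car: "\<mu> \<in> carrier_vec (r + s)" using ker by (simp add: deg_kernel_def)
  have "(laurent_monom \<mu> :: 'k laurent) \<in> graded_piece r s p ds L (0\<^sub>v (p + length ds))"
    unfolding graded_piece_eq_span using ker nonneg
    by (intro laurent.span_base imageI) (simp add: exponents_def deg_kernel_def)
  then obtain c :: 'k where "laurent_monom \<mu> = laurent_const c"
    using positive by (auto simp: positive_grading_def)
  then have "Poly_Mapping.keys (laurent_monom \<mu> :: 'k laurent) \<subseteq> {0}"
    by (simp add: laurent_const_def)
  then have "exponent_of \<mu> = 0" by (simp add: laurent_monom_eq_single)
  then have "\<mu> $ i = 0" if "i < r + s" for i
    using lookup_exponent_of[of \<mu> i] car that by simp
  then show ?thesis using car by (auto intro!: eq_vecI)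
qed

theorem theorem8p3:
  fixes r s n p l :: nat and ds :: "nat list" and L K :: "int mat" and a \<phi> :: "int vec"
  assumes n: "n = r + s"
    and ds: "\<forall>d\<in>set ds. 0 < d"
    and L: "L \<in> carrier_mat (p + length ds) n"
    and faithful: "acts_faithfully TYPE('k::{alg_closed_field,field_char_0}) r s p ds L"
    and l: "l = n - p"
    and K: "K \<in> carrier_mat n l"
    and basis: "columns_form_Z_basis K (deg_kernel n p ds L)"
    and positive: "positive_grading TYPE('k) r s p ds L"
    and a: "a \<in> deg p ds L ` exponents r s"
    and \<phi>: "\<phi> \<in> exponents r s" "deg p ds L \<phi> = a"
  shows "bounded_vecs (fiber_polytope r K \<phi>)
    \<and> finite (fiber_polytope r K \<phi> \<inter> dual_lattice l)
    \<and> (\<exists>B. finite B \<and> laurent.span B = (graded_piece r s p ds L a :: 'k laurent set))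
    \<and> laurent.dim (graded_piece r s p ds L a :: 'k laurent set)
        = card (fiber_polytope r K \<phi> \<inter> dual_lattice l)"
proof -
  have car: "\<phi> \<in> carrier_vec (r + s)" using \<phi> by (simp add: exponents_def)
  note L' = L[unfolded n] and K' = K[unfolded n] and basis' = basis[unfolded n]
  let ?C = "{c \<in> carrier_vec l. \<forall>i<r. - \<phi> $ i \<le> (K *\<^sub>v c) $ i}"
  let ?E = "{\<mu> \<in> exponents r s. deg p ds L \<mu> = a}"
  \<comment> \<open>Positivity of the grading leaves no lattice point in the recession cone except \<open>0\<close>.\<close>
  have "c = 0\<^sub>v l" if c: "c \<in> carrier_vec l" and nonneg: "\<forall>i<r. 0 \<le> (K *\<^sub>v c) $ i" for c
  proof -
    have cols: "set (cols K) \<subseteq> deg_kernel (r + s) p ds L"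
      and uniq: "\<And>x. x \<in> deg_kernel (r + s) p ds L \<Longrightarrow> \<exists>!c. c \<in> carrier_vec l \<and> K *\<^sub>v c = x"
      using basis' K by (auto simp: columns_form_Z_basis_def)
    have ker: "K *\<^sub>v c \<in> deg_kernel (r + s) p ds L"
      by (rule combination_in_deg_kernel[OF L' K' cols c])
    have "K *\<^sub>v c = 0\<^sub>v (r + s)"
      by (rule positive_grading_kernel_exponent[OF positive ker nonneg])
    moreover have "K *\<^sub>v 0\<^sub>v l = 0\<^sub>v (r + s)" using K' by auto
    ultimately show ?thesis using uniq[OF ker] c zero_carrier_vec by metis
  qed
  then have bounded: "bounded_vecs (fiber_polytope r K \<phi>)"
    using bounded_fiber_polytope[OF K'] by simp
  note fin = finite_bounded_lattice_points[OF bounded, of l]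
  have points: "fiber_polytope r K \<phi> \<inter> dual_lattice l = map_vec real_of_int ` ?C"
    using lattice_points_eq[OF K'] by simp
  have bij: "bij_betw (\<lambda>c. \<phi> + K *\<^sub>v c) ?C ?E"
    using fibre_bij[OF L' K' basis' car] \<phi>(2) by simp
  have inj: "inj_on (map_vec real_of_int) ?C"
    using inj_map_vec_of_int by (rule inj_on_subset) simp
  have "finite ?C" using fin inj unfolding points by (rule finite_imageD)
  then have finE: "finite ?E" using bij_betw_finite[OF bij] by simp
  have "laurent.dim (graded_piece r s p ds L a :: 'k laurent set) = card (laurent_monom ` ?E :: 'k laurent set)"
    unfolding graded_piece_eq_span laurent.dim_span
    by (rule laurent.dim_eq_card_independent[OF independent_monomials])
  also have "\<dots> = card ?E"
    by (rule card_image, rule inj_on_laurent_monom[of _ "r + s"]) (auto simp: exponents_def)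
  also have "\<dots> = card ?C" using bij_betw_same_card[OF bij] by simp
  also have "\<dots> = card (fiber_polytope r K \<phi> \<inter> dual_lattice l)"
    unfolding points using card_image[OF inj] by simp
  finally show ?thesis
    using bounded fin finE graded_piece_eq_span[where 'k = 'k, of r s p ds L a] by blast
qed

end
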